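(* Let $X$ be a complex Banach space, let $(L(X),\|\cdot\|)$ be the space of bounded linear operators on $X$ equipped with the operator norm, and let $\mathcal{K}(\mathbb{D})$ be the set of compact subsets of the closed unit disc $\mathbb{D}\subset\mathbb{C}$, equipped with the Hausdorff topology. Then the spectrum map $$\sigma : (L(X),\|\cdot\|) \longrightarrow \mathcal{K}(\mathbb{D}), \qquad T \longmapsto \sigma(T) = \{\lambda \in \mathbb{D} : T-\lambda I \text{ is not invertible}\}$$ is upper semicontinuous.
   Context: $\mathbb{D}=\{z\in\mathbb{C}: |z|\le 1\}$ is the closed unit disc and $I$ is the identity operator on $X$. Here $\sigma(T)$ denotes the part of the usual spectrum lying in $\mathbb{D}$, i.e. $\sigma(T)=\{\lambda\in\mathbb{D}: T-\lambda I \text{ is not invertible in } L(X)\}$; it may be empty. $\mathcal{K}(\mathbb{D})$ is the set of all compact subsets of $\mathbb{D}$, including the empty set. The Hausdorff topology on $\mathcal{K}(\mathbb{D})$ is the topology generated by all sets of the form $\{F\in\mathcal{K}(\mathbb{D}): F\cap V\neq\emptyset\}$ and $\{F\in\mathcal{K}(\mathbb{D}): F\subseteq V\}$, with $V$ open in $\mathbb{D}$ (relative topology). The operator norm is $\|T\|=\sup_{x\in B_X}\|T(x)\|$, with $B_X$ the unit ball of $X$. Upper semicontinuity of a map $\Phi$ from a topological space $Y$ into $\mathcal{K}(\mathbb{D})$ means that for every open subset $V$ of $\mathbb{D}$ the set $\{y\in Y: \Phi(y)\subseteq V\}$ is open in $Y$. *)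

theory Defs
  imports "HOL-Analysis.Analysis"
begin

class complex_banach = banach +
  fixes scaleC :: "complex \<Rightarrow> 'a \<Rightarrow> 'a"  (infixr \<open>*\<^sub>C\<close> 75)
  assumes scaleC_add_right: "c *\<^sub>C (x + y) = c *\<^sub>C x + c *\<^sub>C y"
    and scaleC_add_left: "(c + d) *\<^sub>C x = c *\<^sub>C x + d *\<^sub>C x"
    and scaleC_scaleC: "c *\<^sub>C d *\<^sub>C x = (c * d) *\<^sub>C x"
    and scaleC_one: "1 *\<^sub>C x = x"
    and scaleC_of_real: "complex_of_real r *\<^sub>C x = r *\<^sub>R x"
    and norm_scaleC: "norm (c *\<^sub>C x) = cmod c * norm x"

instantiation complex :: complex_banach
begin

definition scaleC_complex :: "complex \<Rightarrow> complex \<Rightarrow> complex"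
  where "scaleC_complex c x = c * x"

instance
  by standard (simp_all add: scaleC_complex_def algebra_simps norm_mult scaleR_conv_of_real)

end

text \<open>The type of bounded linear maps only provides real linearity, so \<open>L(X)\<close> is the set of
  those operators which moreover commute with complex scalars. Its topology is that of the
  operator norm.\<close>

definition operators :: "('a::complex_banach \<Rightarrow>\<^sub>L 'a) set"
  where "operators = {T. \<forall>c x. blinfun_apply T (c *\<^sub>C x) = c *\<^sub>C blinfun_apply T x}"

abbreviation operator_topology :: "('a::complex_banach \<Rightarrow>\<^sub>L 'a) topology"
  where "operator_topology \<equiv> top_of_set operators"

lift_definition scalar_operator :: "complex \<Rightarrow> 'a::complex_banach \<Rightarrow>\<^sub>L 'a"
  is "\<lambda>c x. c *\<^sub>C x"
proof -
  fix c :: complex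
  show "bounded_linear (\<lambda>x::'a. c *\<^sub>C x)"
  proof (rule bounded_linear_intro)
    fix r :: real and x :: 'a
    show "c *\<^sub>C (r *\<^sub>R x) = r *\<^sub>R (c *\<^sub>C x)"
      by (simp add: scaleC_of_real [symmetric] scaleC_scaleC mult.commute)
  next
    fix x :: 'a
    show "norm (c *\<^sub>C x) \<le> norm x * cmod c"
      by (simp add: norm_scaleC)
  qed (rule scaleC_add_right)
qed

definition invertible_operator :: "('a::complex_banach \<Rightarrow>\<^sub>L 'a) \<Rightarrow> bool"
  where "invertible_operator T \<longleftrightarrow>
    (\<exists>S\<in>operators. S o\<^sub>L T = id_blinfun \<and> T o\<^sub>L S = id_blinfun)"

abbreviation unit_disc :: "complex set"
  where "unit_disc \<equiv> cball 0 1"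

text \<open>Only the part of the usual spectrum inside the closed unit disc; it may be empty.\<close>

definition disc_spectrum :: "('a::complex_banach \<Rightarrow>\<^sub>L 'a) \<Rightarrow> complex set"
  where "disc_spectrum T =
    {c \<in> unit_disc. \<not> invertible_operator (T - scalar_operator c)}"

definition compact_subsets :: "'b topology \<Rightarrow> 'b set set"
  where "compact_subsets D = {F. compactin D F}"

definition hausdorff_topology :: "'b topology \<Rightarrow> 'b set topology"
  where "hausdorff_topology D = topology_generated_by
    ({{F \<in> compact_subsets D. F \<inter> V \<noteq> {}} |V. openin D V} \<union>
     {{F \<in> compact_subsets D. F \<subseteq> V} |V. openin D V})"

lemma topspace_hausdorff_topology: "topspace (hausdorff_topology D) = compact_subsets D"
proof
  show "topspace (hausdorff_topology D) \<subseteq> compact_subsets D"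
    by (auto simp: hausdorff_topology_def topology_generated_by_topspace)
  have "F \<subseteq> topspace D" if "F \<in> compact_subsets D" for F
    using that by (simp add: compact_subsets_def compactin_subset_topspace)
  then show "compact_subsets D \<subseteq> topspace (hausdorff_topology D)"
    unfolding hausdorff_topology_def topology_generated_by_topspace by blast
qed

text \<open>The first conjunct says that \<open>\<Phi>\<close> really takes its values in the hyperspace of compact
  subsets of \<open>D\<close>.\<close>

definition upper_semicontinuous_map ::
    "'y topology \<Rightarrow> 'b topology \<Rightarrow> ('y \<Rightarrow> 'b set) \<Rightarrow> bool"
  where "upper_semicontinuous_map Y D \<Phi> \<longleftrightarrow>
    \<Phi> \<in> topspace Y \<rightarrow> topspace (hausdorff_topology D) \<and>
    (\<forall>V. openin D V \<longrightarrow> openin Y {y \<in> topspace Y. \<Phi> y \<subseteq> V})"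

end

theory Submission imports Defs begin

text \<open>
  If \<open>A\<close> has the inverse \<open>S\<close> and \<open>B\<close> is so close to \<open>A\<close> that \<open>\<parallel>S\<parallel> \<parallel>B - A\<parallel> < 1\<close>, then
  \<open>B x = y\<close> is the fixed point equation \<open>x = S (y - (B - A) x)\<close> of a contraction, hence
  uniquely solvable (\<open>invertible_operator_perturbation\<close>); so invertibility is an open condition
  (\<open>openin_invertible_operators\<close>).
  Since \<open>T - c I\<close> depends continuously on the pair \<open>(T, c)\<close>, the graph
  \<open>{(T, c). T - c I is not invertible}\<close> is closed (\<open>closedin_spectrum_graph\<close>). Its sections over
  the disc are therefore compact. For an open \<open>V\<close>, the operators whose spectrum is not contained
  in \<open>V\<close> form the projection of the part of the graph over the compact set \<open>unit_disc - V\<close>,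
  and projection along a compact factor is a closed map. This is upper semicontinuity.
\<close>

text \<open>The lower bound is exactly the boundedness of the set-theoretic inverse; complex linearity
  of the inverse follows from that of \<open>T\<close> because preimages are unique.\<close>

lemma invertible_operatorI:
  fixes T :: "'a::complex_banach \<Rightarrow>\<^sub>L 'a"
  assumes T: "T \<in> operators"
    and bij: "\<And>y. \<exists>!x. blinfun_apply T x = y"
    and lower_bound: "\<And>x. norm x \<le> norm (blinfun_apply T x) * K"
  shows "invertible_operator T"
proof -
  define g where "g y = (THE x. blinfun_apply T x = y)" for y
  have Tg: "blinfun_apply T (g y) = y" for y
    unfolding g_def by (rule theI') (rule bij)
  have g_eqI: "g y = x" if "blinfun_apply T x = y" for x y
    using bij[of y] Tg[of y] that by blast
  have "bounded_linear g"
  proof (rule bounded_linear_intro)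
    show "g (x + y) = g x + g y" for x y
      by (rule g_eqI) (simp add: blinfun.add_right Tg)
    show "g (r *\<^sub>R x) = r *\<^sub>R g x" for r x
      by (rule g_eqI) (simp add: blinfun.scaleR_right Tg)
    show "norm (g y) \<le> norm y * K" for y
      using lower_bound[of "g y"] by (simp add: Tg)
  qed
  then have G: "blinfun_apply (Blinfun g) = g"
    by (rule bounded_linear_Blinfun_apply)
  have "g (c *\<^sub>C x) = c *\<^sub>C g x" for c x
    using T by (intro g_eqI) (simp add: operators_def Tg)
  then have "Blinfun g \<in> operators"
    by (simp add: operators_def G)
  moreover have "Blinfun g o\<^sub>L T = id_blinfun" "T o\<^sub>L Blinfun g = id_blinfun"
    by (auto intro!: blinfun_eqI g_eqI simp: G Tg)
  ultimately show ?thesis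
    by (auto simp: invertible_operator_def)
qed

text \<open>A fixed point argument takes the place of the Neumann series for \<open>B\<^sup>-\<^sup>1\<close>. The same
  contraction yields the lower bound \<open>(1 - q) \<parallel>x\<parallel> \<le> \<parallel>S\<parallel> \<parallel>B x\<parallel>\<close> and so the boundedness of the
  inverse.\<close>

lemma invertible_operator_perturbation:
  fixes A B S :: "'a::complex_banach \<Rightarrow>\<^sub>L 'a"
  assumes B: "B \<in> operators"
    and SA: "S o\<^sub>L A = id_blinfun" and AS: "A o\<^sub>L S = id_blinfun"
    and close: "norm S * norm (B - A) < 1"
  shows "invertible_operator B"
proof -
  define q where "q = norm S * norm (B - A)"
  define \<Phi> where "\<Phi> y x = blinfun_apply S (y - blinfun_apply (B - A) x)" for y x
  have q: "0 \<le> q" "q < 1"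
    using close by (auto simp: q_def)
  have SA_apply: "blinfun_apply S (blinfun_apply A x) = x"
    and AS_apply: "blinfun_apply A (blinfun_apply S x) = x" for x
    using arg_cong[OF SA, of "\<lambda>L. blinfun_apply L x"]
      arg_cong[OF AS, of "\<lambda>L. blinfun_apply L x"] by simp_all
  have fixed_point_iff: "\<Phi> y x = x \<longleftrightarrow> blinfun_apply B x = y" for x y
  proof -
    have "\<Phi> y x = x \<longleftrightarrow> y - blinfun_apply (B - A) x = blinfun_apply A x"
      unfolding \<Phi>_def by (metis SA_apply AS_apply)
    then show ?thesis
      by (auto simp: blinfun.diff_left algebra_simps)
  qed
  have norm_diff: "norm (blinfun_apply S (blinfun_apply (B - A) x)) \<le> q * norm x" for x
  proof -
    have "norm (blinfun_apply S (blinfun_apply (B - A) x))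
        \<le> norm S * norm (blinfun_apply (B - A) x)"
      by (rule norm_blinfun)
    also have "\<dots> \<le> norm S * (norm (B - A) * norm x)"
      by (intro mult_left_mono norm_blinfun norm_ge_zero)
    finally show ?thesis
      by (simp add: q_def mult.assoc)
  qed
  show ?thesis
  proof (rule invertible_operatorI[OF B])
    fix y
    have "dist (\<Phi> y u) (\<Phi> y v) \<le> q * dist u v" for u v
    proof -
      have "\<Phi> y u - \<Phi> y v = blinfun_apply S (blinfun_apply (B - A) (v - u))"
        by (simp add: \<Phi>_def blinfun.diff_right)
      then show ?thesis
        using norm_diff[of "v - u"] by (simp add: dist_norm norm_minus_commute)
    qed
    then have "\<exists>!x. \<Phi> y x = x"
      using banach_fix_type[OF q] by blast
    then show "\<exists>!x. blinfun_apply B x = y"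
      by (simp add: fixed_point_iff)
  next
    fix x
    have "x = blinfun_apply S (blinfun_apply B x) - blinfun_apply S (blinfun_apply (B - A) x)"
      by (simp add: blinfun.diff_left blinfun.diff_right SA_apply)
    then have "norm x \<le> norm (blinfun_apply S (blinfun_apply B x)) + q * norm x"
      by (smt (verit) norm_triangle_ineq4 norm_diff)
    also have "\<dots> \<le> norm S * norm (blinfun_apply B x) + q * norm x"
      by (simp add: norm_blinfun)
    finally show "norm x \<le> norm (blinfun_apply B x) * (norm S / (1 - q))"
      using q by (simp add: field_simps)
  qed
qed

lemma openin_invertible_operators:
  "openin operator_topology {T \<in> operators. invertible_operator (T::'a::complex_banach \<Rightarrow>\<^sub>L 'a)}"
proof -
  have "\<exists>e>0. \<forall>B\<in>operators. dist B A < e \<longrightarrow> invertible_operator B"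
    if A: "invertible_operator A" for A :: "'a \<Rightarrow>\<^sub>L 'a"
  proof -
    obtain S where S: "S o\<^sub>L A = id_blinfun" "A o\<^sub>L S = id_blinfun"
      using A unfolding invertible_operator_def by blast
    \<comment> \<open>On a trivial space \<open>S\<close> is zero, so \<open>\<parallel>S\<parallel>\<close> itself cannot be the denominator.\<close>
    let ?e = "1 / (norm S + 1)"
    have "invertible_operator B" if "B \<in> operators" "dist B A < ?e" for B
    proof -
      have "norm (B - A) * (norm S + 1) < 1"
        using that(2) by (simp add: dist_norm pos_less_divide_eq add_nonneg_pos)
      moreover have "norm S * norm (B - A) \<le> norm (B - A) * (norm S + 1)"
        by (simp add: distrib_left mult.commute[of "norm S"])
      ultimately have "norm S * norm (B - A) < 1"
        by linarith
      then show ?thesis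
        using that(1) S invertible_operator_perturbation by blast
    qed
    then show ?thesis
      by (intro exI[of _ ?e]) (auto simp: add_nonneg_pos)
  qed
  then show ?thesis
    by (auto simp: openin_euclidean_subtopology_iff)
qed

lemma diff_scalar_operator_in_operators:
  fixes T :: "'a::complex_banach \<Rightarrow>\<^sub>L 'a"
  assumes "T \<in> operators"
  shows "T - scalar_operator c \<in> operators"
proof -
  have scaleC_diff_right: "d *\<^sub>C (x - y) = d *\<^sub>C x - d *\<^sub>C y" for d and x y :: 'a
    using scaleC_add_right[of d "x - y" y] by simp
  have "c *\<^sub>C d *\<^sub>C x = d *\<^sub>C c *\<^sub>C x" for d and x :: 'a
    by (simp only: scaleC_scaleC mult.commute)
  then show ?thesis
    using assms
    by (simp add: operators_def blinfun.diff_left scalar_operator.rep_eq scaleC_diff_right)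
qed

lemma bounded_linear_scalar_operator:
  "bounded_linear (scalar_operator :: complex \<Rightarrow> 'a::complex_banach \<Rightarrow>\<^sub>L 'a)"
proof (rule bounded_linear_intro)
  fix c d :: complex and r :: real
  show "scalar_operator (c + d) = scalar_operator c + (scalar_operator d :: 'a \<Rightarrow>\<^sub>L 'a)"
    by (rule blinfun_eqI) (simp add: scalar_operator.rep_eq blinfun.add_left scaleC_add_left)
  show "scalar_operator (r *\<^sub>R c) = r *\<^sub>R (scalar_operator c :: 'a \<Rightarrow>\<^sub>L 'a)"
    by (rule blinfun_eqI)
      (simp add: scalar_operator.rep_eq blinfun.scaleR_left scaleR_conv_of_real
        scaleC_of_real[symmetric] scaleC_scaleC)
  show "norm (scalar_operator c :: 'a \<Rightarrow>\<^sub>L 'a) \<le> norm c * 1"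
    by (rule norm_blinfun_bound) (simp_all add: scalar_operator.rep_eq norm_scaleC)
qed

text \<open>The set \<open>K\<close> of scalars is left arbitrary because two choices matter: the whole disc for the
  compactness of a spectrum, and the complement of an open set for semicontinuity.\<close>

lemma closedin_spectrum_graph:
  "closedin (top_of_set (operators \<times> K))
     {(T::'a::complex_banach \<Rightarrow>\<^sub>L 'a, c) \<in> operators \<times> K.
       \<not> invertible_operator (T - scalar_operator c)}"
proof -
  let ?D = "\<lambda>p::('a \<Rightarrow>\<^sub>L 'a) \<times> complex. fst p - scalar_operator (snd p)"
  have "continuous_on (operators \<times> K) ?D"
    by (intro continuous_intros bounded_linear.continuous_on[OF bounded_linear_scalar_operator])
  moreover have "?D \<in> operators \<times> K \<rightarrow> operators"
    by (auto intro: diff_scalar_operator_in_operators)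
  moreover have "closedin operator_topology
      (operators - {T \<in> operators. invertible_operator (T::'a \<Rightarrow>\<^sub>L 'a)})"
    using openin_invertible_operators by (auto simp: openin_closedin_eq)
  ultimately have "closedin (top_of_set (operators \<times> K))
      ((operators \<times> K) \<inter> ?D -` (operators - {T \<in> operators. invertible_operator T}))"
    by (rule continuous_closedin_preimage_gen)
  also have "(operators \<times> K) \<inter> ?D -` (operators - {T \<in> operators. invertible_operator T}) =
      {(T, c) \<in> operators \<times> K. \<not> invertible_operator (T - scalar_operator c)}"
    by (auto intro: diff_scalar_operator_in_operators)
  finally show ?thesis .
qed

text \<open>The spectrum is the section of the closed graph at \<open>T\<close>, read off along \<open>c \<mapsto> (T, c)\<close>.\<close>

lemma compact_disc_spectrum:
  fixes T :: "'a::complex_banach \<Rightarrow>\<^sub>L 'a"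
  assumes "T \<in> operators"
  shows "compact (disc_spectrum T)"
proof -
  have "continuous_on unit_disc (\<lambda>c. (T, c))" "(\<lambda>c. (T, c)) \<in> unit_disc \<rightarrow> operators \<times> unit_disc"
    using assms by (auto intro!: continuous_intros)
  from continuous_closedin_preimage_gen[OF this closedin_spectrum_graph]
  have "closedin (top_of_set unit_disc) (unit_disc \<inter> (\<lambda>c. (T, c)) -`
      {(T, c) \<in> operators \<times> unit_disc. \<not> invertible_operator (T - scalar_operator c)})" .
  also have "unit_disc \<inter> (\<lambda>c. (T, c)) -`
      {(T, c) \<in> operators \<times> unit_disc. \<not> invertible_operator (T - scalar_operator c)} =
      disc_spectrum T"
    using assms by (auto simp: disc_spectrum_def)
  finally show ?thesis
    using closedin_compact compact_cball by blast
qed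

theorem proposition2p1:
  "upper_semicontinuous_map
     (operator_topology :: ('a::complex_banach \<Rightarrow>\<^sub>L 'a) topology)
     (top_of_set unit_disc)
     disc_spectrum"
  unfolding upper_semicontinuous_map_def
proof (intro conjI allI impI)
  show "disc_spectrum \<in> topspace (operator_topology :: ('a \<Rightarrow>\<^sub>L 'a) topology) \<rightarrow>
      topspace (hausdorff_topology (top_of_set unit_disc))"
  proof (rule Pi_I)
    fix T :: "'a \<Rightarrow>\<^sub>L 'a"
    assume "T \<in> topspace operator_topology"
    moreover have "disc_spectrum T \<subseteq> unit_disc"
      by (auto simp: disc_spectrum_def)
    ultimately show "disc_spectrum T \<in> topspace (hausdorff_topology (top_of_set unit_disc))"
      by (simp add: topspace_hausdorff_topology compact_subsets_def compactin_subtopology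
          compact_disc_spectrum)
  qed
next
  fix V :: "complex set"
  assume V: "openin (top_of_set unit_disc) V"
  define K where "K = unit_disc - V"
  have "compact K"
    unfolding K_def using V closedin_compact[OF compact_cball]
    by (auto simp: openin_closedin_eq)
  let ?G = "{(T::'a \<Rightarrow>\<^sub>L 'a, c) \<in> operators \<times> K.
      \<not> invertible_operator (T - scalar_operator c)}"
  have "closed_map (prod_topology operator_topology (top_of_set K))
      (operator_topology :: ('a \<Rightarrow>\<^sub>L 'a) topology) fst"
    using \<open>compact K\<close> by (intro Abstract_Topological_Spaces.closed_map_fst)
      (simp add: compact_space_subtopology)
  then have "closedin operator_topology (fst ` ?G)"
    using closedin_spectrum_graph[where 'a='a and K=K]
    by (simp add: closed_map_def prod_topology_subtopology_eu)
  then have "openin operator_topology (operators - fst ` ?G)"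
    by (auto simp: closedin_def)
  also have "operators - fst ` ?G = {T \<in> operators. disc_spectrum T \<subseteq> V}"
    by (force simp: K_def disc_spectrum_def)
  finally show "openin operator_topology
      {T \<in> topspace (operator_topology :: ('a \<Rightarrow>\<^sub>L 'a) topology). disc_spectrum T \<subseteq> V}"
    by simp
qed

end
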